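(* Let $S$ be a set of sorts and $\Sigma$ an $S$-sorted signature such that, for every $S$-sorted set $A$, the support $\{s\in S\mid \mathrm{T}_\Sigma(A)_s\neq\varnothing\}$ of the free $\Sigma$-algebra $\mathbf{T}_\Sigma(A)$ is finite (equivalently, $S$ is finite). Then the ordered set $\mathbf{Form}_{\mathrm{Cgr}_{\mathrm{fi}}}(\Sigma)$ of all formations of finite index congruences with respect to $\Sigma$, ordered pointwise by inclusion, is an algebraic lattice.
   Context: Fix a Grothendieck universe $\mathcal{U}$, a set of sorts $S\in\mathcal{U}$ and an $S$-sorted signature $\Sigma$, i.e. a family of sets $\Sigma_{w,s}\in\mathcal{U}$ indexed by $w\in S^{\star}$ (finite words on $S$) and $s\in S$. An $S$-sorted set is a family $A=(A_s)_{s\in S}$ of sets in $\mathcal{U}$ (components may be empty); it is finite if $\coprod_{s\in S}A_s$ is finite; $\mathcal{U}^S$ is the set of all $S$-sorted sets. A $\Sigma$-algebra $\mathbf{A}$ is an $S$-sorted set $A$ with an operation $F_\sigma\colon A_w=\prod_{i<|w|}A_{w_i}\to A_s$ for each $\sigma\in\Sigma_{w,s}$. Homomorphisms are $S$-sorted (componentwise) mappings commuting with all operations. Epimorphism means homomorphism surjective in each sort. A congruence on $\mathbf{A}$ is a family $\Phi=(\Phi_s)_{s\in S}$ of equivalence relations $\Phi_s$ on $A_s$ compatible with all operations; $\Phi$ is of finite index if $A/\Phi$ is a finite $S$-sorted set. $\mathbf{Cgr}(\mathbf{A})$ is the lattice of all congruences under componentwise inclusion, $\mathbf{A}/\Phi$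 the quotient algebra and $\mathrm{pr}^{\Phi}\colon\mathbf{A}\to\mathbf{A}/\Phi$ the projection. $\mathbf{T}_\Sigma(A)$ is the free $\Sigma$-algebra on $A$. $\mathrm{Ker}(f)$ is the (componentwise) kernel congruence of $f$. A formation of congruences with respect to $\Sigma$ is a function $\mathfrak{F}$ on $\mathcal{U}^S$ such that: (1) for every $A\in\mathcal{U}^S$, $\mathfrak{F}(A)$ is a filter of $\mathbf{Cgr}(\mathbf{T}_\Sigma(A))$ (nonempty, closed under binary intersection, upward closed); (2) for all $A,B\in\mathcal{U}^S$, $\Theta\in\mathfrak{F}(B)$ and homomorphisms $f\colon\mathbf{T}_\Sigma(A)\to\mathbf{T}_\Sigma(B)$, if $\mathrm{pr}^{\Theta}\circ f$ is an epimorphism, then $\mathrm{Ker}(\mathrm{pr}^{\Theta}\circ f)\in\mathfrak{F}(A)$. It is a formation of finite index congruences if moreover, for every $A$, every member of $\mathfrak{F}(A)$ is of finite index. The order is $\mathfrak{F}\le\mathfrak{G}$ iff $\mathfrak{F}(A)\subseteq\mathfrak{G}(A)$ for all $A\in\mathcal{U}^S$. An algebraic lattice is a complete lattice in which every element is a join of compact elements. *)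

theory Defs
  imports "HOL-Library.FuncSet" "HOL-Algebra.Complete_Lattice"
begin

section \<open>Grothendieck universes\<close>

text \<open>
  The type \<open>'u\<close> is the universe, \<open>elts x\<close> is the set of members of \<open>x\<close>, and
  \<open>range elts :: 'u set set\<close> is the collection of the sets that belong to the universe. By
  extensionality and foundation (and Mostowski collapse) such structures are, up to isomorphism,
  exactly the Grothendieck universes with their membership relation. Families of small sets
  indexed by a small set have small unions; closure under images follows by taking singletons.
  The axiom of infinity is not imposed, so universes are covered both with and without it.
\<close>

locale grothendieck_universe =
  fixes elts :: "'u \<Rightarrow> 'u set"
  assumes extensionality: "inj elts"
    and foundation: "wf {(x, y). x \<in> elts y}"
    and pairing: "{x, y} \<in> range elts"
    and subsets: "X \<subseteq> elts x \<Longrightarrow> X \<in> range elts"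
    and powerset: "{y. elts y \<subseteq> elts x} \<in> range elts"
    and family_union: "(\<Union>y\<in>elts x. elts (f y)) \<in> range elts"

section \<open>Many-sorted sets, algebras and homomorphisms\<close>

text \<open>
  Families indexed by the set of sorts \<open>S\<close> are extensional functions on \<open>S\<close>, so that equality of
  families is equality of functions. In particular \<open>S \<rightarrow>\<^sub>E U\<close> is the set of all \<open>S\<close>-sorted sets
  with components in \<open>U\<close>. A signature is a family \<open>\<Sigma> w s\<close>, of which only the members with
  \<open>w \<in> lists S\<close> and \<open>s \<in> S\<close> matter.
\<close>

definition support :: "'s set \<Rightarrow> ('s \<Rightarrow> 'a set) \<Rightarrow> 's set"
  where "support S A = {s \<in> S. A s \<noteq> {}}"

definition finite_sorted :: "'s set \<Rightarrow> ('s \<Rightarrow> 'a set) \<Rightarrow> bool"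
  where "finite_sorted S A \<longleftrightarrow> finite (SIGMA s:S. A s)"

definition tuples :: "('s \<Rightarrow> 'a set) \<Rightarrow> 's list \<Rightarrow> 'a list set"
  where "tuples A w = {xs. list_all2 (\<lambda>x s. x \<in> A s) xs w}"

text \<open>
  The sets \<open>\<Sigma> w s\<close> need not be disjoint, hence an operation depends on \<open>w\<close>, \<open>s\<close> and \<open>\<sigma> \<in> \<Sigma> w s\<close>.
\<close>

record ('s, 'f, 'a) sorted_algebra =
  carr :: "'s \<Rightarrow> 'a set"
  oper :: "'s list \<Rightarrow> 's \<Rightarrow> 'f \<Rightarrow> 'a list \<Rightarrow> 'a"

definition is_algebra ::
    "'s set \<Rightarrow> ('s list \<Rightarrow> 's \<Rightarrow> 'f set) \<Rightarrow> ('s, 'f, 'a) sorted_algebra \<Rightarrow> bool"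
  where "is_algebra S \<Sigma> \<A> \<longleftrightarrow> carr \<A> \<in> extensional S \<and>
    (\<forall>w\<in>lists S. \<forall>s\<in>S. \<forall>\<sigma>\<in>\<Sigma> w s. oper \<A> w s \<sigma> \<in> tuples (carr \<A>) w \<rightarrow> carr \<A> s)"

definition homomorphism :: "'s set \<Rightarrow> ('s list \<Rightarrow> 's \<Rightarrow> 'f set) \<Rightarrow> ('s, 'f, 'a) sorted_algebra \<Rightarrow>
    ('s, 'f, 'b) sorted_algebra \<Rightarrow> ('s \<Rightarrow> 'a \<Rightarrow> 'b) \<Rightarrow> bool"
  where "homomorphism S \<Sigma> \<A> \<B> f \<longleftrightarrow>
    (\<forall>s\<in>S. f s \<in> carr \<A> s \<rightarrow> carr \<B> s) \<and>
    (\<forall>w\<in>lists S. \<forall>s\<in>S. \<forall>\<sigma>\<in>\<Sigma> w s. \<forall>xs\<in>tuples (carr \<A>) w.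
      f s (oper \<A> w s \<sigma> xs) = oper \<B> w s \<sigma> (map2 f w xs))"

definition epimorphism :: "'s set \<Rightarrow> ('s list \<Rightarrow> 's \<Rightarrow> 'f set) \<Rightarrow> ('s, 'f, 'a) sorted_algebra \<Rightarrow>
    ('s, 'f, 'b) sorted_algebra \<Rightarrow> ('s \<Rightarrow> 'a \<Rightarrow> 'b) \<Rightarrow> bool"
  where "epimorphism S \<Sigma> \<A> \<B> f \<longleftrightarrow>
    homomorphism S \<Sigma> \<A> \<B> f \<and> (\<forall>s\<in>S. f s ` carr \<A> s = carr \<B> s)"

section \<open>Congruences\<close>

definition Cgr :: "'s set \<Rightarrow> ('s list \<Rightarrow> 's \<Rightarrow> 'f set) \<Rightarrow> ('s, 'f, 'a) sorted_algebra \<Rightarrow>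
    ('s \<Rightarrow> ('a \<times> 'a) set) set"
  where "Cgr S \<Sigma> \<A> = {\<Phi> \<in> extensional S.
    (\<forall>s\<in>S. equiv (carr \<A> s) (\<Phi> s)) \<and>
    (\<forall>w\<in>lists S. \<forall>s\<in>S. \<forall>\<sigma>\<in>\<Sigma> w s. \<forall>xs\<in>tuples (carr \<A>) w. \<forall>ys\<in>tuples (carr \<A>) w.
      (\<forall>i<length w. (xs ! i, ys ! i) \<in> \<Phi> (w ! i)) \<longrightarrow>
      (oper \<A> w s \<sigma> xs, oper \<A> w s \<sigma> ys) \<in> \<Phi> s)}"

text \<open>
  The operation on classes is the union of the classes of the values at all representatives, as
  for functions that respect an equivalence relation in the theory \<open>Equiv_Relations\<close>.
\<close>

definition quotient_algebra :: "'s set \<Rightarrow> ('s, 'f, 'a) sorted_algebra \<Rightarrow>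
    ('s \<Rightarrow> ('a \<times> 'a) set) \<Rightarrow> ('s, 'f, 'a set) sorted_algebra"
  where "quotient_algebra S \<A> \<Phi> = \<lparr>
    carr = (\<lambda>s\<in>S. carr \<A> s // \<Phi> s),
    oper = (\<lambda>w s \<sigma> Xs. \<Union>xs\<in>{xs. list_all2 (\<in>) xs Xs}. \<Phi> s `` {oper \<A> w s \<sigma> xs})\<rparr>"

definition pr :: "('s \<Rightarrow> ('a \<times> 'a) set) \<Rightarrow> 's \<Rightarrow> 'a \<Rightarrow> 'a set"
  where "pr \<Phi> s x = \<Phi> s `` {x}"

definition Ker :: "'s set \<Rightarrow> ('s, 'f, 'a) sorted_algebra \<Rightarrow> ('s \<Rightarrow> 'a \<Rightarrow> 'b) \<Rightarrow>
    's \<Rightarrow> ('a \<times> 'a) set"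
  where "Ker S \<A> f = (\<lambda>s\<in>S. {(x, y). x \<in> carr \<A> s \<and> y \<in> carr \<A> s \<and> f s x = f s y})"

definition finite_index :: "'s set \<Rightarrow> ('s, 'f, 'a) sorted_algebra \<Rightarrow>
    ('s \<Rightarrow> ('a \<times> 'a) set) \<Rightarrow> bool"
  where "finite_index S \<A> \<Phi> \<longleftrightarrow> finite_sorted S (carr (quotient_algebra S \<A> \<Phi>))"

section \<open>Free algebras\<close>

datatype ('s, 'f, 'a) trm = Var 's 'a | Op "'s list" 's 'f "('s, 'f, 'a) trm list"

inductive wf_trm :: "'s set \<Rightarrow> ('s list \<Rightarrow> 's \<Rightarrow> 'f set) \<Rightarrow> ('s \<Rightarrow> 'a set) \<Rightarrow>
    ('s, 'f, 'a) trm \<Rightarrow> 's \<Rightarrow> bool"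
  for S :: "'s set" and \<Sigma> :: "'s list \<Rightarrow> 's \<Rightarrow> 'f set" and A :: "'s \<Rightarrow> 'a set"
  where
    Var: "s \<in> S \<Longrightarrow> x \<in> A s \<Longrightarrow> wf_trm S \<Sigma> A (Var s x) s"
  | Op: "w \<in> lists S \<Longrightarrow> s \<in> S \<Longrightarrow> \<sigma> \<in> \<Sigma> w s \<Longrightarrow> list_all2 (wf_trm S \<Sigma> A) ts w \<Longrightarrow>
      wf_trm S \<Sigma> A (Op w s \<sigma> ts) s"

definition free_algebra :: "'s set \<Rightarrow> ('s list \<Rightarrow> 's \<Rightarrow> 'f set) \<Rightarrow> ('s \<Rightarrow> 'a set) \<Rightarrow>
    ('s, 'f, ('s, 'f, 'a) trm) sorted_algebra"
  where "free_algebra S \<Sigma> A = \<lparr>carr = (\<lambda>s\<in>S. {t. wf_trm S \<Sigma> A t s}), oper = Op\<rparr>"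

section \<open>Formations of congruences\<close>

definition cgr_filter :: "'s set \<Rightarrow> ('s list \<Rightarrow> 's \<Rightarrow> 'f set) \<Rightarrow> ('s, 'f, 'a) sorted_algebra \<Rightarrow>
    ('s \<Rightarrow> ('a \<times> 'a) set) set \<Rightarrow> bool"
  where "cgr_filter S \<Sigma> \<A> \<F> \<longleftrightarrow> \<F> \<subseteq> Cgr S \<Sigma> \<A> \<and> \<F> \<noteq> {} \<and>
    (\<forall>\<Phi>\<in>\<F>. \<forall>\<Psi>\<in>\<F>. (\<lambda>s\<in>S. \<Phi> s \<inter> \<Psi> s) \<in> \<F>) \<and>
    (\<forall>\<Phi>\<in>\<F>. \<forall>\<Psi>\<in>Cgr S \<Sigma> \<A>. (\<forall>s\<in>S. \<Phi> s \<subseteq> \<Psi> s) \<longrightarrow> \<Psi> \<in> \<F>)"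

type_synonym ('s, 'f, 'a) cgr_assignment =
  "('s \<Rightarrow> 'a set) \<Rightarrow> ('s \<Rightarrow> (('s, 'f, 'a) trm \<times> ('s, 'f, 'a) trm) set) set"

definition formation :: "'a set set \<Rightarrow> 's set \<Rightarrow> ('s list \<Rightarrow> 's \<Rightarrow> 'f set) \<Rightarrow>
    ('s, 'f, 'a) cgr_assignment \<Rightarrow> bool"
  where "formation U S \<Sigma> \<FF> \<longleftrightarrow> \<FF> \<in> extensional (S \<rightarrow>\<^sub>E U) \<and>
    (\<forall>A\<in>S \<rightarrow>\<^sub>E U. cgr_filter S \<Sigma> (free_algebra S \<Sigma> A) (\<FF> A)) \<and>
    (\<forall>A\<in>S \<rightarrow>\<^sub>E U. \<forall>B\<in>S \<rightarrow>\<^sub>E U. \<forall>\<Theta>\<in>\<FF> B. \<forall>f.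
      homomorphism S \<Sigma> (free_algebra S \<Sigma> A) (free_algebra S \<Sigma> B) f \<longrightarrow>
      epimorphism S \<Sigma> (free_algebra S \<Sigma> A) (quotient_algebra S (free_algebra S \<Sigma> B) \<Theta>)
        (\<lambda>s. pr \<Theta> s \<circ> f s) \<longrightarrow>
      Ker S (free_algebra S \<Sigma> A) (\<lambda>s. pr \<Theta> s \<circ> f s) \<in> \<FF> A)"

definition finite_index_formation :: "'a set set \<Rightarrow> 's set \<Rightarrow> ('s list \<Rightarrow> 's \<Rightarrow> 'f set) \<Rightarrow>
    ('s, 'f, 'a) cgr_assignment \<Rightarrow> bool"
  where "finite_index_formation U S \<Sigma> \<FF> \<longleftrightarrow> formation U S \<Sigma> \<FF> \<and>
    (\<forall>A\<in>S \<rightarrow>\<^sub>E U. \<forall>\<Phi>\<in>\<FF> A. finite_index S (free_algebra S \<Sigma> A) \<Phi>)"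

definition Form_Cgr_fi :: "'a set set \<Rightarrow> 's set \<Rightarrow> ('s list \<Rightarrow> 's \<Rightarrow> 'f set) \<Rightarrow>
    ('s, 'f, 'a) cgr_assignment gorder"
  where "Form_Cgr_fi U S \<Sigma> = \<lparr>
    carrier = {\<FF>. finite_index_formation U S \<Sigma> \<FF>},
    eq = (=),
    le = (\<lambda>\<FF> \<GG>. \<forall>A\<in>S \<rightarrow>\<^sub>E U. \<FF> A \<subseteq> \<GG> A)\<rparr>"

section \<open>Algebraic lattices\<close>

definition compact_element :: "('a, 'b) gorder_scheme \<Rightarrow> 'a \<Rightarrow> bool"
  where "compact_element L k \<longleftrightarrow> k \<in> carrier L \<and>
    (\<forall>X \<subseteq> carrier L. k \<sqsubseteq>\<^bsub>L\<^esub> \<Squnion>\<^bsub>L\<^esub> X \<longrightarrow> (\<exists>Y \<subseteq> X. finite Y \<and> k \<sqsubseteq>\<^bsub>L\<^esub> \<Squnion>\<^bsub>L\<^esub> Y))"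

definition algebraic_lattice :: "('a, 'b) gorder_scheme \<Rightarrow> bool"
  where "algebraic_lattice L \<longleftrightarrow> complete_lattice L \<and>
    (\<forall>x\<in>carrier L. \<exists>K. (\<forall>k\<in>K. compact_element L k) \<and> x = \<Squnion>\<^bsub>L\<^esub> K)"

section \<open>Basic facts\<close>

lemma is_algebra_free_algebra: "is_algebra S \<Sigma> (free_algebra S \<Sigma> A)"
  unfolding is_algebra_def
proof (intro conjI ballI funcsetI)
  show "carr (free_algebra S \<Sigma> A) \<in> extensional S"
    by (simp add: free_algebra_def)
next
  fix w s \<sigma> ts
  assume w: "w \<in> lists S" and s: "s \<in> S" and \<sigma>: "\<sigma> \<in> \<Sigma> w s"
    and ts: "ts \<in> tuples (carr (free_algebra S \<Sigma> A)) w"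
  have "list_all2 (wf_trm S \<Sigma> A) ts w"
    using ts w by (auto simp: tuples_def free_algebra_def list_all2_conv_all_nth in_lists_conv_set)
  then show "oper (free_algebra S \<Sigma> A) w s \<sigma> ts \<in> carr (free_algebra S \<Sigma> A) s"
    using w s \<sigma> by (simp add: free_algebra_def wf_trm.Op)
qed

lemma epimorphism_pr:
  assumes alg: "is_algebra S \<Sigma> \<A>" and \<Phi>: "\<Phi> \<in> Cgr S \<Sigma> \<A>"
  shows "epimorphism S \<Sigma> \<A> (quotient_algebra S \<A> \<Phi>) (pr \<Phi>)"
proof -
  have eqv: "equiv (carr \<A> s) (\<Phi> s)" if "s \<in> S" for s
    using \<Phi> that by (simp add: Cgr_def)
  have op: "pr \<Phi> s (oper \<A> w s \<sigma> xs) = oper (quotient_algebra S \<A> \<Phi>) w s \<sigma> (map2 (pr \<Phi>) w xs)"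
    if w: "w \<in> lists S" and s: "s \<in> S" and \<sigma>: "\<sigma> \<in> \<Sigma> w s" and xs: "xs \<in> tuples (carr \<A>) w"
    for w s \<sigma> xs
  proof -
    have len: "length xs = length w" and el: "\<And>i. i < length w \<Longrightarrow> xs ! i \<in> carr \<A> (w ! i)"
      using xs by (auto simp: tuples_def list_all2_conv_all_nth)
    have inS: "\<And>i. i < length w \<Longrightarrow> w ! i \<in> S"
      using w by (auto simp: in_lists_conv_set)
    let ?R = "{ys. list_all2 (\<in>) ys (map2 (pr \<Phi>) w xs)}"
    have R: "ys \<in> ?R \<longleftrightarrow> length ys = length w \<and> (\<forall>i<length w. (xs ! i, ys ! i) \<in> \<Phi> (w ! i))" for ys
      by (auto simp: list_all2_conv_all_nth pr_def len)
    have refl: "xs \<in> ?R"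
      unfolding R using el inS eqv len by (auto simp: equiv_def refl_on_def)
    have const: "\<Phi> s `` {oper \<A> w s \<sigma> ys} = \<Phi> s `` {oper \<A> w s \<sigma> xs}" if ys: "ys \<in> ?R" for ys
    proof -
      have rel: "length ys = length w" "\<forall>i<length w. (xs ! i, ys ! i) \<in> \<Phi> (w ! i)"
        using ys unfolding R by auto
      have "ys \<in> tuples (carr \<A>) w"
        using rel inS eqv by (fastforce simp: tuples_def list_all2_conv_all_nth equiv_def)
      then have "(oper \<A> w s \<sigma> xs, oper \<A> w s \<sigma> ys) \<in> \<Phi> s"
        using \<Phi> w s \<sigma> xs rel by (auto simp: Cgr_def)
      then show ?thesis
        using equiv_class_eq[OF eqv[OF s]] by blast
    qed
    have "?R \<noteq> {}"
      using refl by blast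
    then have "(\<Union>ys\<in>?R. \<Phi> s `` {oper \<A> w s \<sigma> ys}) = \<Phi> s `` {oper \<A> w s \<sigma> xs}"
      by (rule SUP_eq_const) (rule const)
    then show ?thesis
      by (simp add: quotient_algebra_def pr_def)
  qed
  moreover have "pr \<Phi> s ` carr \<A> s = carr (quotient_algebra S \<A> \<Phi>) s" if "s \<in> S" for s
    using that by (auto simp: quotient_algebra_def pr_def quotient_def)
  ultimately show ?thesis
    unfolding epimorphism_def homomorphism_def by blast
qed

lemma finite_support_free_algebra_iff:
  assumes "X \<in> U" "X \<noteq> {}"
  shows "(\<forall>A\<in>S \<rightarrow>\<^sub>E U. finite (support S (carr (free_algebra S \<Sigma> A)))) \<longleftrightarrow> finite S"
proof
  assume *: "\<forall>A\<in>S \<rightarrow>\<^sub>E U. finite (support S (carr (free_algebra S \<Sigma> A)))"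
  let ?A = "\<lambda>s\<in>S. X"
  obtain x where "x \<in> X"
    using assms(2) by blast
  then have "wf_trm S \<Sigma> ?A (Var s x) s" if "s \<in> S" for s
    using that by (simp add: wf_trm.Var)
  then have "support S (carr (free_algebra S \<Sigma> ?A)) = S"
    by (fastforce simp: support_def free_algebra_def)
  moreover have "?A \<in> S \<rightarrow>\<^sub>E U"
    using assms(1) by auto
  ultimately show "finite S"
    using * by metis
qed (auto simp: support_def)

lemma (in grothendieck_universe) finite_support_free_algebra_iff:
  "(\<forall>A\<in>S \<rightarrow>\<^sub>E range elts. finite (support S (carr (free_algebra S \<Sigma> A)))) \<longleftrightarrow> finite S"
  by (rule Defs.finite_support_free_algebra_iff[OF pairing[of undefined undefined]]) simp

end

theory Submission
  imports Defs
begin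

text \<open>
  The finite index formations are closed under pointwise intersections of nonempty families and
  under pointwise directed unions, because the closure condition on kernels involves a single
  congruence \<open>\<Theta>\<close> at a time. As supports are finite, total congruences have finite index, so the
  assignment of all finite index congruences is the greatest finite index formation. An algebraic
  closure system is an algebraic lattice: the formation generated by a single congruence is
  compact, and every formation is the join of those generated by its members.
\<close>

section \<open>Algebraic closure systems of families of sets\<close>

text \<open>Pointwise intersections are the infima and yield, for each index and each point of a
  value there, a least member of \<open>C\<close> with that point. Closure under directed unions
  enters only to show that these least members are compact: a point of a union already lies in one
  of the sets united.\<close>

lemma algebraic_lattice_closure_system:
  fixes D :: "'d set" and C :: "('d \<Rightarrow> 'b set) set"
  defines "L \<equiv> \<lparr>carrier = C, eq = (=), le = (\<lambda>F G. \<forall>A\<in>D. F A \<subseteq> G A)\<rparr>"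
  assumes ext: "C \<subseteq> extensional D"
    and top: "T \<in> C" "\<And>F A. F \<in> C \<Longrightarrow> A \<in> D \<Longrightarrow> F A \<subseteq> T A"
    and inter: "\<And>X. X \<subseteq> C \<Longrightarrow> X \<noteq> {} \<Longrightarrow> (\<lambda>A\<in>D. \<Inter>F\<in>X. F A) \<in> C"
    and directed: "\<And>X. X \<subseteq> C \<Longrightarrow> X \<noteq> {} \<Longrightarrow>
      (\<And>F G. F \<in> X \<Longrightarrow> G \<in> X \<Longrightarrow> \<exists>H\<in>X. \<forall>A\<in>D. F A \<union> G A \<subseteq> H A) \<Longrightarrow>
      (\<lambda>A\<in>D. \<Union>F\<in>X. F A) \<in> C"
  shows "algebraic_lattice L"
proof -
  have carrier[simp]: "carrier L = C"
    by (simp add: L_def)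
  have le: "F \<sqsubseteq>\<^bsub>L\<^esub> G \<longleftrightarrow> (\<forall>A\<in>D. F A \<subseteq> G A)" for F G
    by (simp add: L_def)
  interpret partial_order L
  proof unfold_locales
    fix F G
    assume FG: "F \<in> carrier L" "G \<in> carrier L" "F \<sqsubseteq>\<^bsub>L\<^esub> G" "G \<sqsubseteq>\<^bsub>L\<^esub> F"
    \<comment> \<open>The order compares values on \<open>D\<close> alone; the members of
      \<open>C\<close> are extensional, so agreement on \<open>D\<close> is equality.\<close>
    then have "F = G"
      using ext by (intro extensionalityI[of F D G]) (auto simp: le)
    then show "F .=\<^bsub>L\<^esub> G"
      by (simp add: L_def)
  qed (auto simp: L_def)
  \<comment> \<open>By this criterion only nonempty families need an infimum. The empty intersection
    would be \<open>UNIV\<close> at each index; the greatest element \<open>T\<close> takes its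
    place.\<close>
  interpret complete_lattice L
  proof (rule complete_lattice_criterion1)
    show "\<exists>g. greatest L g (carrier L)"
      using top by (auto simp: greatest_def le)
    show "\<exists>i. greatest L i (Lower L X)" if "X \<subseteq> carrier L" "X \<noteq> {}" for X
    proof (intro exI greatest_LowerI)
      show "(\<lambda>A\<in>D. \<Inter>F\<in>X. F A) \<in> carrier L"
        using inter that by simp
    qed (use that in \<open>auto simp: le Lower_def\<close>)
  qed
  \<comment> \<open>The least member of \<open>C\<close> whose value at \<open>A\<close> contains
    \<open>\<Phi>\<close>, provided that such a member exists. The facts below therefore carry a
    witness \<open>F\<close>, which makes the family intersected nonempty.\<close>
  define gen where "gen A \<Phi> = (\<lambda>B\<in>D. \<Inter>F\<in>{F \<in> C. \<Phi> \<in> F A}. F B)" for A \<Phi>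
  have gen_C: "gen A \<Phi> \<in> C" and gen_mem: "\<Phi> \<in> gen A \<Phi> A"
    if "F \<in> C" "A \<in> D" "\<Phi> \<in> F A" for A \<Phi> F
    unfolding gen_def using that by (auto intro: inter)
  have gen_le: "gen A \<Phi> \<sqsubseteq>\<^bsub>L\<^esub> F" if "F \<in> C" "\<Phi> \<in> F A" for A \<Phi> F
    using that by (auto simp: le gen_def)
  have compact: "compact_element L (gen A \<Phi>)" if "F \<in> C" "A \<in> D" "\<Phi> \<in> F A" for A \<Phi> F
    unfolding compact_element_def
  proof (intro conjI allI impI)
    show "gen A \<Phi> \<in> carrier L"
      using gen_C that by simp
    fix X
    assume X: "X \<subseteq> carrier L" and below: "gen A \<Phi> \<sqsubseteq>\<^bsub>L\<^esub> \<Squnion>\<^bsub>L\<^esub>X"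
    let ?J = "{\<Squnion>\<^bsub>L\<^esub>Y |Y. Y \<subseteq> X \<and> finite Y}"
    let ?H = "\<lambda>A\<in>D. \<Union>F\<in>?J. F A"
    have J: "\<Squnion>\<^bsub>L\<^esub>Y \<in> C" if "Y \<subseteq> X" for Y
      using sup_closed[of Y] that X by auto
    have mono: "\<Squnion>\<^bsub>L\<^esub>Y \<sqsubseteq>\<^bsub>L\<^esub> \<Squnion>\<^bsub>L\<^esub>Z" if "Y \<subseteq> Z" "Z \<subseteq> X" for Y Z
      using that X J by (intro sup_least) (auto intro!: sup_upper)
    have H: "?H \<in> C"
    proof (rule directed)
      show "?J \<subseteq> C"
        using J by blast
      show "\<exists>H\<in>?J. \<forall>A\<in>D. F A \<union> G A \<subseteq> H A" if FG: "F \<in> ?J" "G \<in> ?J" for F G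
      proof -
        obtain Y Z where "F = \<Squnion>\<^bsub>L\<^esub>Y" "Y \<subseteq> X" "finite Y" "G = \<Squnion>\<^bsub>L\<^esub>Z" "Z \<subseteq> X" "finite Z"
          using FG by blast
        then show ?thesis
          using mono[of Y "Y \<union> Z"] mono[of Z "Y \<union> Z"]
          by (intro bexI[of _ "\<Squnion>\<^bsub>L\<^esub>(Y \<union> Z)"]) (auto simp: le)
      qed
    qed auto
    \<comment> \<open>Singletons are finite, so \<open>?H\<close> dominates every member of
      \<open>X\<close>. As \<open>?H\<close> is in \<open>C\<close>, it dominates the supremum
      too.\<close>
    have "F \<sqsubseteq>\<^bsub>L\<^esub> ?H" if "F \<in> X" for F
    proof -
      have "F \<sqsubseteq>\<^bsub>L\<^esub> \<Squnion>\<^bsub>L\<^esub>{F}"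
        using that X by (intro sup_upper) auto
      moreover have "\<Squnion>\<^bsub>L\<^esub>{F} \<in> ?J"
        using that by blast
      ultimately show ?thesis
        unfolding le by auto
    qed
    then have "\<Squnion>\<^bsub>L\<^esub>X \<sqsubseteq>\<^bsub>L\<^esub> ?H"
      using H X by (intro sup_least) auto
    \<comment> \<open>Evaluation at \<open>A\<close> turns the inequality into membership in a
      union, which selects one finite join containing \<open>\<Phi>\<close>; by leastness
      \<open>gen A \<Phi>\<close> lies below that join.\<close>
    then have "\<Phi> \<in> ?H A"
      using below gen_mem[OF that] \<open>A \<in> D\<close> unfolding le by blast
    then obtain Y where Y: "Y \<subseteq> X" "finite Y" "\<Phi> \<in> (\<Squnion>\<^bsub>L\<^esub>Y) A"
      using \<open>A \<in> D\<close> by auto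
    then show "\<exists>Y\<subseteq>X. finite Y \<and> gen A \<Phi> \<sqsubseteq>\<^bsub>L\<^esub> \<Squnion>\<^bsub>L\<^esub>Y"
      using gen_le[OF J[OF Y(1)] Y(3)] by blast
  qed
  have "\<exists>K. (\<forall>k\<in>K. compact_element L k) \<and> F = \<Squnion>\<^bsub>L\<^esub>K" if F: "F \<in> carrier L" for F
  proof (intro exI conjI)
    let ?K = "{gen A \<Phi> |A \<Phi>. A \<in> D \<and> \<Phi> \<in> F A}"
    show "\<forall>k\<in>?K. compact_element L k"
      using compact[of F] F by auto
    have K: "?K \<subseteq> carrier L"
      using gen_C[of F] F by auto
    have "\<Squnion>\<^bsub>L\<^esub>?K \<sqsubseteq>\<^bsub>L\<^esub> F"
      using gen_le[of F] F by (intro sup_least K) auto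
    \<comment> \<open>Each \<open>\<Phi>\<close> in \<open>F A\<close> belongs to the value at
      \<open>A\<close> of its own generated element, hence to the value of the join.\<close>
    moreover have "F \<sqsubseteq>\<^bsub>L\<^esub> \<Squnion>\<^bsub>L\<^esub>?K"
      unfolding le
    proof (intro ballI subsetI)
      fix A \<Phi>
      assume A: "A \<in> D" "\<Phi> \<in> F A"
      have "gen A \<Phi> \<sqsubseteq>\<^bsub>L\<^esub> \<Squnion>\<^bsub>L\<^esub>?K"
        using A by (intro sup_upper K) blast
      then show "\<Phi> \<in> (\<Squnion>\<^bsub>L\<^esub>?K) A"
        using gen_mem[of F A \<Phi>] F A unfolding le carrier by blast
    qed
    ultimately show "F = \<Squnion>\<^bsub>L\<^esub>?K"
      using F sup_closed[OF K] by (intro le_antisym)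
  qed
  then show ?thesis
    using complete_lattice_axioms by (simp add: algebraic_lattice_def)
qed

section \<open>Congruences of finite index\<close>

lemma Cgr_total:
  assumes "is_algebra S \<Sigma> \<A>"
  shows "(\<lambda>s\<in>S. carr \<A> s \<times> carr \<A> s) \<in> Cgr S \<Sigma> \<A>"
  using assms by (auto simp: Cgr_def is_algebra_def equiv_def refl_on_def sym_def trans_def Pi_iff)

lemma Cgr_Int:
  assumes "\<Phi> \<in> Cgr S \<Sigma> \<A>" "\<Psi> \<in> Cgr S \<Sigma> \<A>"
  shows "(\<lambda>s\<in>S. \<Phi> s \<inter> \<Psi> s) \<in> Cgr S \<Sigma> \<A>"
proof -
  have "equiv (carr \<A> s) (\<Phi> s \<inter> \<Psi> s)" if "s \<in> S" for s
  proof -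
    have "equiv (carr \<A> s) (\<Phi> s)" "equiv (carr \<A> s) (\<Psi> s)"
      using assms that by (auto simp: Cgr_def)
    then show ?thesis
      by (auto simp: equiv_def refl_on_def intro: sym_Int trans_Int)
  qed
  \<comment> \<open>The intersection is a restricted function, so its value at the letter
    \<open>w ! i\<close> unfolds only once that letter is known to be in \<open>S\<close>.\<close>
  moreover have "w ! i \<in> S" if "w \<in> lists S" "i < length w" for w i
    using that by auto
  ultimately show ?thesis
    using assms by (auto simp: Cgr_def)
qed

lemma Cgr_Ker:
  assumes alg: "is_algebra S \<Sigma> \<A>" and hom: "homomorphism S \<Sigma> \<A> \<B> f"
  shows "Ker S \<A> f \<in> Cgr S \<Sigma> \<A>"
proof -
  have "(oper \<A> w s \<sigma> xs, oper \<A> w s \<sigma> ys) \<in> Ker S \<A> f s"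
    if w: "w \<in> lists S" and s: "s \<in> S" "\<sigma> \<in> \<Sigma> w s"
      and xs: "xs \<in> tuples (carr \<A>) w" and ys: "ys \<in> tuples (carr \<A>) w"
      and rel: "\<forall>i<length w. (xs ! i, ys ! i) \<in> Ker S \<A> f (w ! i)" for w s \<sigma> xs ys
  proof -
    have "w ! i \<in> S" if "i < length w" for i
      using that w by auto
    \<comment> \<open>Arguments related by the kernel have the same image tuple, so the homomorphism
      law gives both operation values the same image.\<close>
    then have "map2 f w xs = map2 f w ys"
      using xs ys rel by (intro nth_equalityI) (auto simp: tuples_def list_all2_conv_all_nth Ker_def)
    then have "f s (oper \<A> w s \<sigma> xs) = f s (oper \<A> w s \<sigma> ys)"
      using hom w s xs ys by (simp add: homomorphism_def)
    moreover have "oper \<A> w s \<sigma> xs \<in> carr \<A> s" "oper \<A> w s \<sigma> ys \<in> carr \<A> s"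
      using alg w s xs ys by (auto simp: is_algebra_def Pi_iff)
    ultimately show ?thesis
      using s by (simp add: Ker_def)
  qed
  then show ?thesis
    by (auto simp: Cgr_def Ker_def equiv_def refl_on_def sym_def trans_def)
qed

section \<open>Counting congruence classes\<close>

lemma finite_index_iff: "finite_index S \<A> \<Phi> \<longleftrightarrow> finite (SIGMA s:S. carr \<A> s // \<Phi> s)"
proof -
  have "(SIGMA s:S. carr (quotient_algebra S \<A> \<Phi>) s) = (SIGMA s:S. carr \<A> s // \<Phi> s)"
    by (auto simp: quotient_algebra_def)
  then show ?thesis
    by (simp add: finite_index_def finite_sorted_def)
qed

text \<open>A nonempty carrier is a single class and an empty one has no class, so the classes are
  counted by the support. This is where finiteness of supports enters.\<close>

lemma finite_index_total:
  assumes "finite (support S (carr \<A>))"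
  shows "finite_index S \<A> (\<lambda>s\<in>S. carr \<A> s \<times> carr \<A> s)"
  unfolding finite_index_iff
proof (rule finite_subset)
  show "(SIGMA s:S. carr \<A> s // (\<lambda>s\<in>S. carr \<A> s \<times> carr \<A> s) s)
    \<subseteq> (\<lambda>s. (s, carr \<A> s)) ` support S (carr \<A>)"
    by (auto simp: support_def quotient_def)
qed (use assms in simp)

text \<open>A class of the intersection is the intersection of two classes, so pairs of classes
  cover all cases. Pairs with distinct sorts only enlarge the covering set.\<close>

lemma finite_index_Int:
  assumes "finite_index S \<A> \<Phi>" "finite_index S \<A> \<Psi>"
  shows "finite_index S \<A> (\<lambda>s\<in>S. \<Phi> s \<inter> \<Psi> s)"
  unfolding finite_index_iff
proof (rule finite_subset)
  have "(\<Phi> s \<inter> \<Psi> s) `` {x} = \<Phi> s `` {x} \<inter> \<Psi> s `` {x}" for s x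
    by auto
  then show "(SIGMA s:S. carr \<A> s // (\<lambda>s\<in>S. \<Phi> s \<inter> \<Psi> s) s)
    \<subseteq> (\<lambda>((s, c), (t, d)). (s, c \<inter> d)) `
        ((SIGMA s:S. carr \<A> s // \<Phi> s) \<times> (SIGMA s:S. carr \<A> s // \<Psi> s))"
    by (fastforce simp: quotient_def image_iff)
qed (use assms in \<open>simp add: finite_index_iff\<close>)

lemma finite_index_mono:
  assumes \<Phi>: "\<Phi> \<in> Cgr S \<Sigma> \<A>" and \<Psi>: "\<Psi> \<in> Cgr S \<Sigma> \<A>"
    and le: "\<forall>s\<in>S. \<Phi> s \<subseteq> \<Psi> s" and fin: "finite_index S \<A> \<Phi>"
  shows "finite_index S \<A> \<Psi>"
  unfolding finite_index_iff
proof (rule finite_subset)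
  \<comment> \<open>Reflexivity of \<open>\<Phi>\<close> gives one inclusion,
    \<open>\<Phi> s \<subseteq> \<Psi> s\<close> and transitivity the other. Hence each class of the
    coarser congruence is determined by a class of the finer one.\<close>
  have "\<Psi> s `` {x} = \<Psi> s `` (\<Phi> s `` {x})" if "s \<in> S" "x \<in> carr \<A> s" for s x
  proof -
    have "equiv (carr \<A> s) (\<Phi> s)" "equiv (carr \<A> s) (\<Psi> s)" "\<Phi> s \<subseteq> \<Psi> s"
      using \<Phi> \<Psi> le that by (auto simp: Cgr_def)
    then show ?thesis
      using that by (auto simp: equiv_def refl_on_def elim: transE)
  qed
  then show "(SIGMA s:S. carr \<A> s // \<Psi> s)
    \<subseteq> (\<lambda>(s, c). (s, \<Psi> s `` c)) ` (SIGMA s:S. carr \<A> s // \<Phi> s)"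
    by (fastforce simp: quotient_def image_iff)
qed (use fin in \<open>simp add: finite_index_iff\<close>)

text \<open>The kernel classes are the nonempty fibres of \<open>f\<close>, and the fibres are
  indexed by the elements of the finite target.\<close>

lemma finite_index_Ker:
  assumes hom: "homomorphism S \<Sigma> \<A> \<B> f" and fin: "finite_sorted S (carr \<B>)"
  shows "finite_index S \<A> (Ker S \<A> f)"
  unfolding finite_index_iff
proof (rule finite_subset)
  show "(SIGMA s:S. carr \<A> s // Ker S \<A> f s)
    \<subseteq> (\<lambda>(s, c). (s, {x \<in> carr \<A> s. f s x = c})) ` (SIGMA s:S. carr \<B> s)"
  proof (rule subsetI, clarify)
    fix s c
    assume s: "s \<in> S" and "c \<in> carr \<A> s // Ker S \<A> f s"
    then obtain x where x: "x \<in> carr \<A> s" "c = Ker S \<A> f s `` {x}"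
      by (auto simp: quotient_def)
    then have "c = {y \<in> carr \<A> s. f s y = f s x}"
      using s by (auto simp: Ker_def)
    moreover have "f s x \<in> carr \<B> s"
      using hom s x by (auto simp: homomorphism_def)
    ultimately show "(s, c) \<in> (\<lambda>(s, c). (s, {x \<in> carr \<A> s. f s x = c})) ` (SIGMA s:S. carr \<B> s)"
      using s by (auto simp: image_iff)
  qed
qed (use fin in \<open>simp add: finite_sorted_def\<close>)

section \<open>The closure system of finite index formations\<close>

lemma total_mem_cgr_filter:
  assumes alg: "is_algebra S \<Sigma> \<A>" and "cgr_filter S \<Sigma> \<A> \<F>"
  shows "(\<lambda>s\<in>S. carr \<A> s \<times> carr \<A> s) \<in> \<F>"
proof -
  obtain \<Phi> where \<Phi>: "\<Phi> \<in> \<F>" "\<Phi> \<in> Cgr S \<Sigma> \<A>"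
    using assms(2) by (auto simp: cgr_filter_def)
  then have "\<forall>s\<in>S. \<Phi> s \<subseteq> (\<lambda>s\<in>S. carr \<A> s \<times> carr \<A> s) s"
    by (auto simp: Cgr_def equiv_def)
  then show ?thesis
    using assms(2) \<Phi> Cgr_total[OF alg] by (auto simp: cgr_filter_def)
qed

text \<open>The delicate clause is nonemptiness: all filters share the total congruence, because
  they are nonempty and upward closed. With \<open>I\<close> empty the intersection would be
  \<open>UNIV\<close> and leave the set of congruences.\<close>

lemma cgr_filter_INT:
  assumes alg: "is_algebra S \<Sigma> \<A>" and "I \<noteq> {}" and fil: "\<And>i. i \<in> I \<Longrightarrow> cgr_filter S \<Sigma> \<A> (\<F> i)"
  shows "cgr_filter S \<Sigma> \<A> (\<Inter>i\<in>I. \<F> i)"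
  unfolding cgr_filter_def
proof (intro conjI ballI impI INT_I)
  have "\<F> i \<subseteq> Cgr S \<Sigma> \<A>" if "i \<in> I" for i
    using fil[OF that] by (simp add: cgr_filter_def)
  then show "(\<Inter>i\<in>I. \<F> i) \<subseteq> Cgr S \<Sigma> \<A>"
    using \<open>I \<noteq> {}\<close> by blast
  have "(\<lambda>s\<in>S. carr \<A> s \<times> carr \<A> s) \<in> (\<Inter>i\<in>I. \<F> i)"
    using total_mem_cgr_filter[OF alg fil] by blast
  then show "(\<Inter>i\<in>I. \<F> i) \<noteq> {}"
    by blast
next
  fix \<Phi> \<Psi> i
  assume "\<Phi> \<in> (\<Inter>i\<in>I. \<F> i)" "\<Psi> \<in> (\<Inter>i\<in>I. \<F> i)" "i \<in> I"
  then show "(\<lambda>s\<in>S. \<Phi> s \<inter> \<Psi> s) \<in> \<F> i"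
    using fil[of i] by (simp add: cgr_filter_def)
next
  fix \<Phi> \<Psi> i
  assume "\<Phi> \<in> (\<Inter>i\<in>I. \<F> i)" "\<Psi> \<in> Cgr S \<Sigma> \<A>" "\<forall>s\<in>S. \<Phi> s \<subseteq> \<Psi> s" "i \<in> I"
  moreover from this have "\<Phi> \<in> \<F> i"
    by simp
  ultimately show "\<Psi> \<in> \<F> i"
    using fil[of i] unfolding cgr_filter_def by metis
qed

text \<open>Directedness serves closure under binary intersection: two congruences from different
  filters are first moved into a common one. Upward closure involves one filter at a time.\<close>

lemma cgr_filter_UN_directed:
  assumes "I \<noteq> {}" and fil: "\<And>i. i \<in> I \<Longrightarrow> cgr_filter S \<Sigma> \<A> (\<F> i)"
    and dir: "\<And>i j. i \<in> I \<Longrightarrow> j \<in> I \<Longrightarrow> \<exists>k\<in>I. \<F> i \<union> \<F> j \<subseteq> \<F> k"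
  shows "cgr_filter S \<Sigma> \<A> (\<Union>i\<in>I. \<F> i)"
  unfolding cgr_filter_def
proof (intro conjI ballI impI)
  have "\<F> i \<subseteq> Cgr S \<Sigma> \<A>" "\<F> i \<noteq> {}" if "i \<in> I" for i
    using fil[OF that] by (simp_all add: cgr_filter_def)
  then show "(\<Union>i\<in>I. \<F> i) \<subseteq> Cgr S \<Sigma> \<A>" "(\<Union>i\<in>I. \<F> i) \<noteq> {}"
    using \<open>I \<noteq> {}\<close> by blast+
next
  fix \<Phi> \<Psi>
  assume "\<Phi> \<in> (\<Union>i\<in>I. \<F> i)" "\<Psi> \<in> (\<Union>i\<in>I. \<F> i)"
  then obtain i j where "i \<in> I" "\<Phi> \<in> \<F> i" "j \<in> I" "\<Psi> \<in> \<F> j"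
    by blast
  then obtain k where k: "k \<in> I" "\<Phi> \<in> \<F> k" "\<Psi> \<in> \<F> k"
    using dir[of i j] by blast
  then have "(\<lambda>s\<in>S. \<Phi> s \<inter> \<Psi> s) \<in> \<F> k"
    using fil[of k] by (simp add: cgr_filter_def)
  then show "(\<lambda>s\<in>S. \<Phi> s \<inter> \<Psi> s) \<in> (\<Union>i\<in>I. \<F> i)"
    using k(1) by blast
next
  fix \<Phi> \<Psi>
  assume "\<Phi> \<in> (\<Union>i\<in>I. \<F> i)" and \<Psi>: "\<Psi> \<in> Cgr S \<Sigma> \<A>" "\<forall>s\<in>S. \<Phi> s \<subseteq> \<Psi> s"
  then obtain i where i: "i \<in> I" "\<Phi> \<in> \<F> i"
    by blast
  then have "\<Psi> \<in> \<F> i"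
    using fil[of i] \<Psi> unfolding cgr_filter_def by metis
  then show "\<Psi> \<in> (\<Union>i\<in>I. \<F> i)"
    using i(1) by blast
qed

lemma cgr_filter_finite_index:
  assumes "is_algebra S \<Sigma> \<A>" "finite (support S (carr \<A>))"
  shows "cgr_filter S \<Sigma> \<A> {\<Phi> \<in> Cgr S \<Sigma> \<A>. finite_index S \<A> \<Phi>}"
  unfolding cgr_filter_def
proof (intro conjI ballI impI)
  show "{\<Phi> \<in> Cgr S \<Sigma> \<A>. finite_index S \<A> \<Phi>} \<noteq> {}"
    using Cgr_total[OF assms(1)] finite_index_total[OF assms(2)] by blast
qed (auto intro!: Cgr_Int finite_index_Int intro: finite_index_mono[of _ S \<Sigma> \<A>])

section \<open>Intersections, directed unions and the greatest finite index formation\<close>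

lemma finite_index_formationI:
  assumes "\<FF> \<in> extensional (S \<rightarrow>\<^sub>E U)"
    and "\<And>A. A \<in> S \<rightarrow>\<^sub>E U \<Longrightarrow> cgr_filter S \<Sigma> (free_algebra S \<Sigma> A) (\<FF> A)"
    and "\<And>A \<Phi>. A \<in> S \<rightarrow>\<^sub>E U \<Longrightarrow> \<Phi> \<in> \<FF> A \<Longrightarrow> finite_index S (free_algebra S \<Sigma> A) \<Phi>"
    and "\<And>A B \<Theta> f. A \<in> S \<rightarrow>\<^sub>E U \<Longrightarrow> B \<in> S \<rightarrow>\<^sub>E U \<Longrightarrow> \<Theta> \<in> \<FF> B \<Longrightarrow>
      homomorphism S \<Sigma> (free_algebra S \<Sigma> A) (free_algebra S \<Sigma> B) f \<Longrightarrow>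
      epimorphism S \<Sigma> (free_algebra S \<Sigma> A) (quotient_algebra S (free_algebra S \<Sigma> B) \<Theta>)
        (\<lambda>s. pr \<Theta> s \<circ> f s) \<Longrightarrow>
      Ker S (free_algebra S \<Sigma> A) (\<lambda>s. pr \<Theta> s \<circ> f s) \<in> \<FF> A"
  shows "finite_index_formation U S \<Sigma> \<FF>"
  using assms by (simp add: finite_index_formation_def formation_def)

lemma finite_index_formationD:
  assumes "finite_index_formation U S \<Sigma> \<FF>"
  shows "\<FF> \<in> extensional (S \<rightarrow>\<^sub>E U)"
    and "A \<in> S \<rightarrow>\<^sub>E U \<Longrightarrow> cgr_filter S \<Sigma> (free_algebra S \<Sigma> A) (\<FF> A)"
    and "A \<in> S \<rightarrow>\<^sub>E U \<Longrightarrow> \<Phi> \<in> \<FF> A \<Longrightarrow> finite_index S (free_algebra S \<Sigma> A) \<Phi>"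
    and "A \<in> S \<rightarrow>\<^sub>E U \<Longrightarrow> B \<in> S \<rightarrow>\<^sub>E U \<Longrightarrow> \<Theta> \<in> \<FF> B \<Longrightarrow>
      homomorphism S \<Sigma> (free_algebra S \<Sigma> A) (free_algebra S \<Sigma> B) f \<Longrightarrow>
      epimorphism S \<Sigma> (free_algebra S \<Sigma> A) (quotient_algebra S (free_algebra S \<Sigma> B) \<Theta>)
        (\<lambda>s. pr \<Theta> s \<circ> f s) \<Longrightarrow>
      Ker S (free_algebra S \<Sigma> A) (\<lambda>s. pr \<Theta> s \<circ> f s) \<in> \<FF> A"
  using assms by (simp_all add: finite_index_formation_def formation_def)

text \<open>The premises of the kernel condition mention \<open>\<Theta>\<close> but not the
  formation. So for \<open>\<Theta>\<close> in the intersection the condition applies in every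
  member of \<open>X\<close>, with the same \<open>f\<close>.\<close>

lemma finite_index_formation_INT:
  assumes form: "\<And>\<FF>. \<FF> \<in> X \<Longrightarrow> finite_index_formation U S \<Sigma> \<FF>" and "X \<noteq> {}"
  shows "finite_index_formation U S \<Sigma> (\<lambda>A\<in>S \<rightarrow>\<^sub>E U. \<Inter>\<FF>\<in>X. \<FF> A)"
proof (rule finite_index_formationI)
  show "cgr_filter S \<Sigma> (free_algebra S \<Sigma> A) ((\<lambda>A\<in>S \<rightarrow>\<^sub>E U. \<Inter>\<FF>\<in>X. \<FF> A) A)"
    if A: "A \<in> S \<rightarrow>\<^sub>E U" for A
    unfolding restrict_apply'[OF A]
    using finite_index_formationD(2)[OF form A] \<open>X \<noteq> {}\<close>
    by (intro cgr_filter_INT is_algebra_free_algebra)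
  show "finite_index S (free_algebra S \<Sigma> A) \<Phi>"
    if A: "A \<in> S \<rightarrow>\<^sub>E U" and "\<Phi> \<in> (\<lambda>A\<in>S \<rightarrow>\<^sub>E U. \<Inter>\<FF>\<in>X. \<FF> A) A" for A \<Phi>
    using that(2) finite_index_formationD(3)[OF form A] \<open>X \<noteq> {}\<close>
    unfolding restrict_apply'[OF A] by blast
  show "Ker S (free_algebra S \<Sigma> A) (\<lambda>s. pr \<Theta> s \<circ> f s) \<in> (\<lambda>A\<in>S \<rightarrow>\<^sub>E U. \<Inter>\<FF>\<in>X. \<FF> A) A"
    if A: "A \<in> S \<rightarrow>\<^sub>E U" and B: "B \<in> S \<rightarrow>\<^sub>E U" and \<Theta>: "\<Theta> \<in> (\<lambda>A\<in>S \<rightarrow>\<^sub>E U. \<Inter>\<FF>\<in>X. \<FF> A) B"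
      and f: "homomorphism S \<Sigma> (free_algebra S \<Sigma> A) (free_algebra S \<Sigma> B) f"
        "epimorphism S \<Sigma> (free_algebra S \<Sigma> A) (quotient_algebra S (free_algebra S \<Sigma> B) \<Theta>)
          (\<lambda>s. pr \<Theta> s \<circ> f s)" for A B \<Theta> f
    using \<Theta> finite_index_formationD(4)[OF form A B _ f]
    unfolding restrict_apply'[OF A] restrict_apply'[OF B] by blast
qed simp

text \<open>A given \<open>\<Theta>\<close> comes from one member of \<open>X\<close>, and the
  kernel lands in that same member. Directedness is used for the filter clause.\<close>

lemma finite_index_formation_UN_directed:
  assumes form: "\<And>\<FF>. \<FF> \<in> X \<Longrightarrow> finite_index_formation U S \<Sigma> \<FF>" and "X \<noteq> {}"
    and dir: "\<And>\<FF> \<GG>. \<FF> \<in> X \<Longrightarrow> \<GG> \<in> X \<Longrightarrow> \<exists>\<HH>\<in>X. \<forall>A\<in>S \<rightarrow>\<^sub>E U. \<FF> A \<union> \<GG> A \<subseteq> \<HH> A"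
  shows "finite_index_formation U S \<Sigma> (\<lambda>A\<in>S \<rightarrow>\<^sub>E U. \<Union>\<FF>\<in>X. \<FF> A)"
proof (rule finite_index_formationI)
  show "cgr_filter S \<Sigma> (free_algebra S \<Sigma> A) ((\<lambda>A\<in>S \<rightarrow>\<^sub>E U. \<Union>\<FF>\<in>X. \<FF> A) A)"
    if A: "A \<in> S \<rightarrow>\<^sub>E U" for A
    unfolding restrict_apply'[OF A]
  proof (rule cgr_filter_UN_directed)
    show "\<exists>\<HH>\<in>X. \<FF> A \<union> \<GG> A \<subseteq> \<HH> A" if "\<FF> \<in> X" "\<GG> \<in> X" for \<FF> \<GG>
      using dir[OF that] A by blast
  qed (use finite_index_formationD(2)[OF form A] \<open>X \<noteq> {}\<close> in auto)
  show "finite_index S (free_algebra S \<Sigma> A) \<Phi>"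
    if A: "A \<in> S \<rightarrow>\<^sub>E U" and "\<Phi> \<in> (\<lambda>A\<in>S \<rightarrow>\<^sub>E U. \<Union>\<FF>\<in>X. \<FF> A) A" for A \<Phi>
    using that(2) finite_index_formationD(3)[OF form A]
    unfolding restrict_apply'[OF A] by blast
  show "Ker S (free_algebra S \<Sigma> A) (\<lambda>s. pr \<Theta> s \<circ> f s) \<in> (\<lambda>A\<in>S \<rightarrow>\<^sub>E U. \<Union>\<FF>\<in>X. \<FF> A) A"
    if A: "A \<in> S \<rightarrow>\<^sub>E U" and B: "B \<in> S \<rightarrow>\<^sub>E U" and \<Theta>: "\<Theta> \<in> (\<lambda>A\<in>S \<rightarrow>\<^sub>E U. \<Union>\<FF>\<in>X. \<FF> A) B"
      and f: "homomorphism S \<Sigma> (free_algebra S \<Sigma> A) (free_algebra S \<Sigma> B) f"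
        "epimorphism S \<Sigma> (free_algebra S \<Sigma> A) (quotient_algebra S (free_algebra S \<Sigma> B) \<Theta>)
          (\<lambda>s. pr \<Theta> s \<circ> f s)" for A B \<Theta> f
    using \<Theta> finite_index_formationD(4)[OF form A B _ f]
    unfolding restrict_apply'[OF A] restrict_apply'[OF B] by blast
qed simp

text \<open>For the kernel condition, the composite maps into the quotient by
  \<open>\<Theta>\<close>, which is finite, so its kernel has finite index.\<close>

lemma finite_index_formation_top:
  assumes "\<And>A. A \<in> S \<rightarrow>\<^sub>E U \<Longrightarrow> finite (support S (carr (free_algebra S \<Sigma> A)))"
  shows "finite_index_formation U S \<Sigma> (\<lambda>A\<in>S \<rightarrow>\<^sub>E U.
    {\<Phi> \<in> Cgr S \<Sigma> (free_algebra S \<Sigma> A). finite_index S (free_algebra S \<Sigma> A) \<Phi>})"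
proof (rule finite_index_formationI)
  fix A B \<Theta> f
  assume A: "A \<in> S \<rightarrow>\<^sub>E U" and B: "B \<in> S \<rightarrow>\<^sub>E U"
    and \<Theta>: "\<Theta> \<in> (\<lambda>A\<in>S \<rightarrow>\<^sub>E U.
      {\<Phi> \<in> Cgr S \<Sigma> (free_algebra S \<Sigma> A). finite_index S (free_algebra S \<Sigma> A) \<Phi>}) B"
    and epi: "epimorphism S \<Sigma> (free_algebra S \<Sigma> A) (quotient_algebra S (free_algebra S \<Sigma> B) \<Theta>)
      (\<lambda>s. pr \<Theta> s \<circ> f s)"
  have "finite_sorted S (carr (quotient_algebra S (free_algebra S \<Sigma> B) \<Theta>))"
    using \<Theta> B by (simp add: finite_index_def)
  moreover have "homomorphism S \<Sigma> (free_algebra S \<Sigma> A)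
      (quotient_algebra S (free_algebra S \<Sigma> B) \<Theta>) (\<lambda>s. pr \<Theta> s \<circ> f s)"
    using epi by (simp add: epimorphism_def)
  ultimately show "Ker S (free_algebra S \<Sigma> A) (\<lambda>s. pr \<Theta> s \<circ> f s) \<in> (\<lambda>A\<in>S \<rightarrow>\<^sub>E U.
      {\<Phi> \<in> Cgr S \<Sigma> (free_algebra S \<Sigma> A). finite_index S (free_algebra S \<Sigma> A) \<Phi>}) A"
    using A Cgr_Ker[OF is_algebra_free_algebra] finite_index_Ker by fastforce
qed (use assms in \<open>simp_all add: cgr_filter_finite_index is_algebra_free_algebra\<close>)

theorem algebraic_lattice_Form_Cgr_fi:
  assumes "\<And>A. A \<in> S \<rightarrow>\<^sub>E U \<Longrightarrow> finite (support S (carr (free_algebra S \<Sigma> A)))"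
  shows "algebraic_lattice (Form_Cgr_fi U S \<Sigma>)"
  unfolding Form_Cgr_fi_def
proof (rule algebraic_lattice_closure_system)
  \<comment> \<open>In the closure system lemma, the index set \<open>D\<close> is the set of all
    sorted sets with components in \<open>U\<close>, and \<open>?T\<close> is the greatest
    element.\<close>
  let ?T = "\<lambda>A\<in>S \<rightarrow>\<^sub>E U.
    {\<Phi> \<in> Cgr S \<Sigma> (free_algebra S \<Sigma> A). finite_index S (free_algebra S \<Sigma> A) \<Phi>}"
  show "?T \<in> {\<FF>. finite_index_formation U S \<Sigma> \<FF>}"
    using finite_index_formation_top[OF assms] by simp
  show "\<FF> A \<subseteq> ?T A" if "\<FF> \<in> {\<FF>. finite_index_formation U S \<Sigma> \<FF>}" "A \<in> S \<rightarrow>\<^sub>E U" for \<FF> A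
  proof -
    have form: "finite_index_formation U S \<Sigma> \<FF>"
      using that by simp
    have "\<FF> A \<subseteq> Cgr S \<Sigma> (free_algebra S \<Sigma> A)"
      using finite_index_formationD(2)[OF form that(2)] by (simp add: cgr_filter_def)
    then show ?thesis
      using finite_index_formationD(3)[OF form that(2)] unfolding restrict_apply'[OF that(2)] by blast
  qed
  show "{\<FF>. finite_index_formation U S \<Sigma> \<FF>} \<subseteq> extensional (S \<rightarrow>\<^sub>E U)"
    using finite_index_formationD(1) by blast
  show "(\<lambda>A\<in>S \<rightarrow>\<^sub>E U. \<Inter>\<FF>\<in>X. \<FF> A) \<in> {\<FF>. finite_index_formation U S \<Sigma> \<FF>}"
    if "X \<subseteq> {\<FF>. finite_index_formation U S \<Sigma> \<FF>}" "X \<noteq> {}" for X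
    using that by (intro CollectI finite_index_formation_INT) blast+
  show "(\<lambda>A\<in>S \<rightarrow>\<^sub>E U. \<Union>\<FF>\<in>X. \<FF> A) \<in> {\<FF>. finite_index_formation U S \<Sigma> \<FF>}"
    if X: "X \<subseteq> {\<FF>. finite_index_formation U S \<Sigma> \<FF>}" "X \<noteq> {}"
      and dir: "\<And>\<FF> \<GG>. \<FF> \<in> X \<Longrightarrow> \<GG> \<in> X \<Longrightarrow> \<exists>\<HH>\<in>X. \<forall>A\<in>S \<rightarrow>\<^sub>E U. \<FF> A \<union> \<GG> A \<subseteq> \<HH> A" for X
  proof (intro CollectI finite_index_formation_UN_directed)
    show "finite_index_formation U S \<Sigma> \<FF>" if "\<FF> \<in> X" for \<FF>
      using X(1) that by blast
  qed (fact X(2), fact dir)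
qed

text \<open>Sorts, operation symbols and elements of sorted sets are all members of the universe, so
  one type \<open>'u\<close> serves for the three of them.\<close>

theorem corollary6p15:
  fixes elts :: "'u \<Rightarrow> 'u set" and U :: "'u set set"
    and S :: "'u set" and \<Sigma> :: "'u list \<Rightarrow> 'u \<Rightarrow> 'u set"
  assumes "grothendieck_universe elts" and "U = range elts"
    and "S \<in> U" and "\<And>w s. w \<in> lists S \<Longrightarrow> s \<in> S \<Longrightarrow> \<Sigma> w s \<in> U"
    and "\<And>A. A \<in> S \<rightarrow>\<^sub>E U \<Longrightarrow> finite (support S (carr (free_algebra S \<Sigma> A)))"
  shows "algebraic_lattice (Form_Cgr_fi U S \<Sigma>)"
  using assms(5) by (rule algebraic_lattice_Form_Cgr_fi)

end
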